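(* Let $0<\lambda\le1$ and let $g\in\mathcal{M}_0(\lambda)$ satisfy $\mathrm{area}\,(E(g))=\pi(1-\lambda^2)$. Then $g$ is an extreme point of $\mathcal{M}_0(\lambda)$.
   Context: $\widehat{\mathbb{C}}=\mathbb{C}\cup\{\infty\}$ and $\Delta=\{\zeta\in\widehat{\mathbb{C}}:|\zeta|>1\}$. $\Sigma$ is the class of meromorphic univalent functions $g$ on $\Delta$ of the form $g(\zeta)=\zeta+\sum_{n=0}^\infty b_n\zeta^{-n}$ for $1<|\zeta|<\infty$; write $b_0(g)=b_0$. For $0<\lambda\le1$, $\mathcal{M}(\lambda)=\{g\in\Sigma:|g'(\zeta)-1|<\lambda\text{ in }\Delta\}$ and $\mathcal{M}_0(\lambda)=\{g\in\mathcal{M}(\lambda):b_0(g)=0\}$. $E(g)=\widehat{\mathbb{C}}\setminus g(\Delta)$ is the omitted set of $g$, and $\mathrm{area}$ denotes planar Lebesgue measure. An element $g\in\mathcal{M}_0(\lambda)$ is an extreme point of $\mathcal{M}_0(\lambda)$ if $g=tg_1+(1-t)g_2$ with $g_1,g_2\in\mathcal{M}_0(\lambda)$ and $0<t<1$ implies $g_1=g_2=g$. *)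

theory Defs
  imports "HOL-Complex_Analysis.Complex_Analysis"
begin

text \<open>
  Every \<open>g\<close> in \<open>\<Sigma>\<close> is finite on \<open>1 < |\<zeta>| < \<infinity>\<close> and satisfies \<open>g(\<infinity>) = \<infinity>\<close>, so it is
  represented by a function on the plane of which only the values on \<open>1 < |\<zeta>| < \<infinity>\<close> are
  used; in particular, two such functions are identified if they agree there. With this
  convention univalence on \<open>\<Delta>\<close> is injectivity on \<open>1 < |\<zeta>| < \<infinity>\<close>, and the only pole of
  \<open>g\<close> in \<open>\<Delta>\<close> is the one at \<open>\<infinity>\<close>.
\<close>

definition ext_disc :: "complex set" where
  "ext_disc = {\<zeta>. 1 < norm \<zeta>}"

definition has_expansion :: "(complex \<Rightarrow> complex) \<Rightarrow> (nat \<Rightarrow> complex) \<Rightarrow> bool" where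
  "has_expansion g b \<longleftrightarrow> (\<forall>\<zeta>\<in>ext_disc. (\<lambda>n. b n / \<zeta> ^ n) sums (g \<zeta> - \<zeta>))"

definition class_Sigma :: "(complex \<Rightarrow> complex) set" where
  "class_Sigma =
     {g. g holomorphic_on ext_disc \<and> inj_on g ext_disc \<and> (\<exists>b. has_expansion g b)}"

definition b0 :: "(complex \<Rightarrow> complex) \<Rightarrow> complex" where
  "b0 g = (THE b. has_expansion g b) 0"

lemma has_expansion_unique:
  assumes "has_expansion g b" "has_expansion g c"
  shows "b = c"
proof (rule ccontr)
  define d where "d = (\<lambda>n. b n - c n)"
  have d: "(\<lambda>n. d n * w ^ n) sums 0" if w: "w \<noteq> 0" "norm w < 1" for w
  proof -
    have "inverse w \<in> ext_disc"
      using w by (simp add: ext_disc_def norm_inverse one_less_inverse)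
    then have "(\<lambda>n. b n / inverse w ^ n - c n / inverse w ^ n) sums
        ((g (inverse w) - inverse w) - (g (inverse w) - inverse w))"
      using assms unfolding has_expansion_def by (intro sums_diff) auto
    then show ?thesis
      by (simp add: d_def field_simps power_inverse)
  qed
  assume "b \<noteq> c"
  then obtain k where k: "d k \<noteq> 0" by (auto simp: d_def fun_eq_iff)
  define f where "f w = (if w = 0 then d 0 else 0)" for w :: complex
  have "(\<lambda>n. d n * w ^ n) sums f w" if "norm w < 1" for w
    using d[of w] that powser_sums_zero[of d] by (auto simp: f_def)
  then have sm: "\<And>w. norm w < 1 \<Longrightarrow> (\<lambda>n. d n * (w - 0) ^ n) sums f w" by simp
  have lim: "(f \<longlongrightarrow> d 0) (at 0)"
    by (rule powser_limit_0[of 1]) (use sm in auto)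
  moreover have "(f \<longlongrightarrow> 0) (at 0)"
    by (rule tendsto_eventually) (auto simp: f_def eventually_at_filter)
  ultimately have "d 0 = 0" using LIM_unique by blast
  then have f0: "f w = 0" for w by (simp add: f_def)
  have "0 < k" using k \<open>d 0 = 0\<close> by (cases k) auto
  then obtain s where s: "0 < s" "\<And>z. z \<in> cball 0 s - {0} \<Longrightarrow> f z \<noteq> 0"
    using powser_0_nonzero[OF zero_less_one sm f0 k] by auto
  have "complex_of_real s \<in> cball 0 s - {0}" using s by simp
  then show False using s f0 by blast
qed

lemma b0_eq: "has_expansion g b \<Longrightarrow> b0 g = b 0"
  unfolding b0_def using has_expansion_unique by (metis the_equality)

text \<open>
  At \<open>\<infinity>\<close> the derivative of every \<open>g\<close> in \<open>\<Sigma>\<close> is \<open>1\<close>, so for \<open>l > 0\<close> the bound there is automatic.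
\<close>

definition class_M :: "real \<Rightarrow> (complex \<Rightarrow> complex) set" where
  "class_M l = {g \<in> class_Sigma. \<forall>\<zeta>\<in>ext_disc. norm (deriv g \<zeta> - 1) < l}"

definition class_M0 :: "real \<Rightarrow> (complex \<Rightarrow> complex) set" where
  "class_M0 l = {g \<in> class_M l. b0 g = 0}"

text \<open>Since \<open>\<infinity> = g(\<infinity>)\<close> is attained, the omitted set lies in the finite plane.\<close>

definition omitted_set :: "(complex \<Rightarrow> complex) \<Rightarrow> complex set" where
  "omitted_set g = UNIV - g ` ext_disc"

definition is_extreme_point :: "(complex \<Rightarrow> complex) \<Rightarrow> (complex \<Rightarrow> complex) set \<Rightarrow> bool" where
  "is_extreme_point g F \<longleftrightarrow> g \<in> F \<and>
     (\<forall>g1\<in>F. \<forall>g2\<in>F. \<forall>t::real. 0 < t \<and> t < 1 \<and>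
        (\<forall>\<zeta>\<in>ext_disc. g \<zeta> = of_real t * g1 \<zeta> + of_real (1 - t) * g2 \<zeta>) \<longrightarrow>
        (\<forall>\<zeta>\<in>ext_disc. g1 \<zeta> = g \<zeta> \<and> g2 \<zeta> = g \<zeta>))"

end

theory Submission
  imports Defs
begin

text \<open>
  For \<open>g\<close> in the class put \<open>G w = g (1 / w) - 1 / w\<close>. Since \<open>b\<^sub>0 = 0\<close>, this is a holomorphic function on
  the unit disc with \<open>G 0 = 0\<close>, and \<open>g' \<zeta> = 1 - G' (1 / \<zeta>) / \<zeta>\<^sup>2\<close>. The bound \<open>|g' - 1| < l\<close> says that
  \<open>|w\<^sup>2 G' w| < l\<close>, which the maximum principle improves to \<open>|G'| \<le> l\<close>
  (\<open>class_M0_obtain_reciprocal\<close>).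

  The area condition forces \<open>|G'| = l\<close> everywhere. By the mean value property the average of
  \<open>|g'|\<^sup>2\<close> over the circle \<open>|\<zeta>| = r\<close> is \<open>1\<close> plus the average of \<open>|G' (1 / \<zeta>)|\<^sup>2 / r\<^sup>4\<close>. Integrating in
  polar coordinates, the image of \<open>1 < |\<zeta>| < R\<close> has area at most \<open>\<pi> (R\<^sup>2 - 1) + \<pi> l\<^sup>2\<close>, and less than
  that by a fixed \<open>\<pi> \<delta>\<close>, independent of \<open>R\<close>, if \<open>|G'|\<close> stays below \<open>l\<close> on \<open>|w| \<le> 1/2\<close>
  (\<open>emeasure_image_exterior_annulus_le\<close>). On the other hand, near infinity \<open>g\<close> is almost the Joukowski
  map \<open>J z = z + \<beta> / z\<close> with \<open>\<beta> = G' 0\<close>: the ellipse bounded by \<open>J (|z| = R - O (1 / R\<^sup>2))\<close>, whose area is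
  \<open>\<pi> R\<^sup>2 - O (1 / R)\<close>, does not meet \<open>g (|\<zeta>| \<ge> R)\<close> and so is covered by the omitted set and the image of the
  annulus. Letting \<open>R\<close> grow, the omitted set has area at least \<open>\<pi> (1 - l\<^sup>2) + \<pi> \<delta>\<close>
  (\<open>omitted_area_strict\<close>). Hence in the situation of the theorem \<open>|G'|\<close> attains the value \<open>l\<close> inside
  the disc, and \<open>G'\<close> is a constant of modulus \<open>l\<close> (\<open>norm_deriv_eq_of_omitted_area\<close>).

  Extremality is then strict convexity of the disc of radius \<open>l\<close>: if \<open>g = t g\<^sub>1 + (1 - t) g\<^sub>2\<close>, then
  \<open>G' = t G\<^sub>1' + (1 - t) G\<^sub>2'\<close> with \<open>|G\<^sub>1'|, |G\<^sub>2'| \<le> l\<close> and \<open>|G'| = l\<close>, so \<open>G\<^sub>1' = G\<^sub>2'\<close>, and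
  \<open>G\<^sub>1 0 = G\<^sub>2 0\<close> gives \<open>G\<^sub>1 = G\<^sub>2\<close>.
\<close>

section \<open>Transport of planar Lebesgue measure\<close>

text \<open>
  Lebesgue measure is determined by its values on boxes, and the preimage of a box under a linear
  bijection of the standard bases is the box with the permuted side lengths. This moves areas and
  integrals between \<open>complex\<close>, \<open>real \<times> real\<close> and \<open>real^2\<close>: the change of variables formula is
  stated for \<open>real^'n\<close>, Fubini's theorem for products.
\<close>

lemma distr_lborel_basis_bij:
  fixes \<phi> :: "'a::euclidean_space \<Rightarrow> 'b::euclidean_space"
  assumes lin: "linear \<phi>" and bij: "bij_betw \<phi> Basis Basis"
  shows "distr lborel borel \<phi> = lborel"
proof (rule lborel_eqI[symmetric])
  have meas: "\<phi> \<in> borel_measurable borel"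
    using linear_continuous_on[of \<phi> UNIV] lin borel_measurable_continuous_onI linear_conv_bounded_linear by blast
  have inner: "\<phi> x \<bullet> \<phi> c = x \<bullet> c" if "c \<in> Basis" for x c
  proof -
    have "\<phi> x = \<phi> (\<Sum>d\<in>Basis. (x \<bullet> d) *\<^sub>R d)" by (simp add: euclidean_representation)
    also have "\<dots> = (\<Sum>d\<in>Basis. (x \<bullet> d) *\<^sub>R \<phi> d)"
      by (simp add: linear_sum[OF lin] linear_scale[OF lin])
    finally have "\<phi> x \<bullet> \<phi> c = (\<Sum>d\<in>Basis. (x \<bullet> d) * (\<phi> d \<bullet> \<phi> c))"
      by (simp add: inner_sum_left)
    also have "\<dots> = (\<Sum>d\<in>Basis. (x \<bullet> d) * (if d = c then 1 else 0))"
    proof (rule sum.cong)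
      fix d :: 'a assume d: "d \<in> Basis"
      have "\<phi> d \<in> Basis" "\<phi> c \<in> Basis" "\<phi> d = \<phi> c \<longleftrightarrow> d = c"
        using bij d that by (auto simp: bij_betw_def inj_on_def)
      then show "(x \<bullet> d) * (\<phi> d \<bullet> \<phi> c) = (x \<bullet> d) * (if d = c then 1 else 0)"
        by (simp add: inner_Basis)
    qed simp
    also have "\<dots> = x \<bullet> c" using that by (simp add: if_distrib[of "(*) _"] cong: if_cong)
    finally show ?thesis .
  qed
  fix l u :: 'b assume le: "\<And>b. b \<in> Basis \<Longrightarrow> l \<bullet> b \<le> u \<bullet> b"
  \<comment> \<open>\<open>p\<close> is the inverse of \<open>\<phi>\<close>, written as the adjoint that it also is\<close>
  define p where "p y = (\<Sum>c\<in>Basis. (y \<bullet> \<phi> c) *\<^sub>R c)" for y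
  have p: "p y \<bullet> c = y \<bullet> \<phi> c" if "c \<in> Basis" for y c
    using that by (simp add: p_def)
  have img: "Basis = \<phi> ` Basis" using bij by (simp add: bij_betw_def)
  have "\<phi> -` box l u = box (p l) (p u)"
    unfolding box_def by (subst img) (auto simp: p inner)
  moreover have "emeasure lborel (box (p l) (p u)) = (\<Prod>b\<in>Basis. (p u - p l) \<bullet> b)"
    using le bij by (subst emeasure_lborel_box) (auto simp: p bij_betw_def)
  moreover have "(\<Prod>b\<in>Basis. (p u - p l) \<bullet> b) = (\<Prod>b\<in>Basis. (u - l) \<bullet> b)"
  proof -
    have "(\<Prod>b\<in>Basis. (p u - p l) \<bullet> b) = (\<Prod>b\<in>Basis. (u - l) \<bullet> \<phi> b)"
      by (rule prod.cong) (simp_all add: inner_diff_left p)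
    also have "\<dots> = (\<Prod>b\<in>Basis. (u - l) \<bullet> b)"
      by (rule prod.reindex_bij_betw[OF bij])
    finally show ?thesis .
  qed
  ultimately show "emeasure (distr lborel borel \<phi>) (box l u) = (\<Prod>b\<in>Basis. (u - l) \<bullet> b)"
    using meas by (subst emeasure_distr) auto
qed (simp)

definition vec_of_complex :: "complex \<Rightarrow> real^2" where
  "vec_of_complex z = vector [Re z, Im z]"

definition vec_of_pair :: "real \<times> real \<Rightarrow> real^2" where
  "vec_of_pair p = vector [fst p, snd p]"

lemma vec_of_complex_nth [simp]: "vec_of_complex z $ 1 = Re z" "vec_of_complex z $ 2 = Im z"
  and vec_of_pair_nth [simp]: "vec_of_pair p $ 1 = fst p" "vec_of_pair p $ 2 = snd p"
  by (simp_all add: vec_of_complex_def vec_of_pair_def)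

lemma linear_vec_of_complex: "linear vec_of_complex"
  and linear_vec_of_pair: "linear vec_of_pair"
  by (auto intro!: linearI simp: vec_eq_iff forall_2)

lemma inj_vec_of_complex: "inj vec_of_complex" and inj_vec_of_pair: "inj vec_of_pair"
  by (auto intro!: injI simp: vec_eq_iff forall_2 complex_eq_iff prod_eq_iff)

lemma Basis_real2: "(Basis :: (real^2) set) = {axis 1 1, axis 2 1}"
  by (auto simp: Basis_vec_def UNIV_2)

lemma distr_vec_of_complex: "distr lborel borel vec_of_complex = lborel"
proof (rule distr_lborel_basis_bij[OF linear_vec_of_complex])
  have "vec_of_complex 1 = axis 1 1" "vec_of_complex \<i> = axis 2 1"
    "axis 1 1 \<noteq> (axis 2 1 :: real^2)"
    by (auto simp: vec_eq_iff forall_2 axis_def)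
  then show "bij_betw vec_of_complex Basis Basis"
    by (auto simp: bij_betw_def Basis_real2 Basis_complex_def
        intro: inj_on_subset[OF inj_vec_of_complex])
qed

lemma distr_vec_of_pair: "distr lborel borel vec_of_pair = lborel"
proof (rule distr_lborel_basis_bij[OF linear_vec_of_pair])
  have "vec_of_pair (1,0) = axis 1 1" "vec_of_pair (0,1) = axis 2 1"
    "axis 1 1 \<noteq> (axis 2 1 :: real^2)"
    by (auto simp: vec_eq_iff forall_2 axis_def)
  then show "bij_betw vec_of_pair Basis Basis"
    by (auto simp: bij_betw_def Basis_real2 Basis_prod_def
        intro: inj_on_subset[OF inj_vec_of_pair])
qed

lemma measure_vec_of_complex_image:
  assumes "compact S"
  shows "measure lebesgue (vec_of_complex ` S) = measure lebesgue S"
proof -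
  have cont: "continuous_on UNIV vec_of_complex"
    using linear_continuous_on linear_conv_bounded_linear linear_vec_of_complex by blast
  have c: "compact (vec_of_complex ` S)"
    using assms compact_continuous_image continuous_on_subset[OF cont] by blast
  have m: "vec_of_complex \<in> borel_measurable borel"
    using cont by (rule borel_measurable_continuous_onI)
  have "measure lebesgue (vec_of_complex ` S) = measure lborel (vec_of_complex ` S)"
    using c by (simp add: measure_completion borel_compact)
  also have "\<dots> = measure (distr lborel borel vec_of_complex) (vec_of_complex ` S)"
    by (simp add: distr_vec_of_complex)
  also have "\<dots> = measure lborel (vec_of_complex -` (vec_of_complex ` S))"
    using m c by (subst measure_distr) (auto simp: borel_compact)
  also have "vec_of_complex -` (vec_of_complex ` S) = S"
    using inj_vec_of_complex by (simp add: inj_vimage_image_eq)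
  also have "measure lborel S = measure lebesgue S"
    using assms by (simp add: measure_completion borel_compact)
  finally show ?thesis .
qed

lemma has_integral_vec_of_pair_image:
  fixes f :: "real^2 \<Rightarrow> real"
  assumes cont: "continuous_on (vec_of_pair ` cbox p q) f"
  shows "(f has_integral integral (cbox p q) (f \<circ> vec_of_pair)) (vec_of_pair ` cbox p q)"
proof -
  let ?S = "vec_of_pair ` cbox p q"
  have contp: "continuous_on A vec_of_pair" for A
    using linear_continuous_on linear_conv_bounded_linear linear_vec_of_pair by blast
  have m: "vec_of_pair \<in> borel_measurable borel"
    using contp by (rule borel_measurable_continuous_onI)
  have c: "compact ?S"
    using compact_continuous_image[OF contp compact_cbox] .
  have ind: "(\<lambda>x. indicator ?S x *\<^sub>R f x) \<in> borel_measurable borel"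
    by (rule borel_measurable_continuous_on_indicator) (use c cont in \<open>auto simp: borel_compact\<close>)
  have i1: "set_integrable lborel ?S f"
    using borel_integrable_compact[OF c cont] by (simp add: set_integrable_def mult.commute
       indicator_scaleR_eq_if if_distrib cong: if_cong)
  have contf: "continuous_on (cbox p q) (f \<circ> vec_of_pair)"
    using cont contp by (intro continuous_on_compose) auto
  have i2: "set_integrable lborel (cbox p q) (f \<circ> vec_of_pair)"
    using borel_integrable_compact[OF compact_cbox contf] by (simp add: set_integrable_def mult.commute
       indicator_scaleR_eq_if if_distrib cong: if_cong)
  have "set_lebesgue_integral lborel ?S f =
      (LINT x|distr lborel borel vec_of_pair. indicator ?S x *\<^sub>R f x)"
    by (simp add: distr_vec_of_pair set_lebesgue_integral_def)
  also have "\<dots> = (LINT x|lborel. indicator ?S (vec_of_pair x) *\<^sub>R f (vec_of_pair x))"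
    using m ind by (subst integral_distr) auto
  also have "\<dots> = set_lebesgue_integral lborel (cbox p q) (f \<circ> vec_of_pair)"
    unfolding set_lebesgue_integral_def
    by (intro Bochner_Integration.integral_cong) (auto simp: indicator_def inj_image_mem_iff[OF inj_vec_of_pair])
  also have "\<dots> = integral (cbox p q) (f \<circ> vec_of_pair)"
    using set_borel_integral_eq_integral(2)[OF i2] .
  finally have "integral ?S f = integral (cbox p q) (f \<circ> vec_of_pair)"
    using set_borel_integral_eq_integral(2)[OF i1] by simp
  then show ?thesis
    using set_borel_integral_eq_integral(1)[OF i1] by (simp add: has_integral_integral)
qed

section \<open>The area of a holomorphic image of an annulus\<close>

definition closed_annulus :: "real \<Rightarrow> real \<Rightarrow> complex set" where
  "closed_annulus a b = {z. a \<le> norm z \<and> norm z \<le> b}"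

lemma compact_closed_annulus: "compact (closed_annulus a b)"
proof -
  have "closed_annulus a b = cball 0 b - ball 0 a" by (auto simp: closed_annulus_def)
  then show ?thesis by (simp add: compact_diff)
qed

lemma inj_on_polar:
  "inj_on (\<lambda>(r, t). of_real r * cis (2 * pi * t)) ({0<..} \<times> {0..<1})"
proof (rule inj_onI, clarsimp)
  fix r t r' t' :: real
  assume r: "0 < r" "0 < r'" and t: "0 \<le> t" "t < 1" "0 \<le> t'" "t' < 1"
    and eq: "of_real r * cis (2 * pi * t) = of_real r' * cis (2 * pi * t')"
  have "r = norm (of_real r * cis (2 * pi * t))" using r by (simp add: norm_mult)
  also have "\<dots> = r'" unfolding eq using r by (simp add: norm_mult)
  finally have "r = r'" .
  have "Arg2pi (of_real r * cis (2 * pi * t)) = 2 * pi * t"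
    using r t by (intro Arg2pi_unique[of r]) (auto simp: cis_conv_exp)
  moreover have "Arg2pi (of_real r * cis (2 * pi * t)) = 2 * pi * t'"
    unfolding eq using r t by (intro Arg2pi_unique[of r']) (auto simp: cis_conv_exp)
  ultimately show "r = r' \<and> t = t'" using \<open>r = r'\<close> by simp
qed

lemma polar_image:
  assumes "0 < a"
  shows "(\<lambda>(r, t). of_real r * cis (2 * pi * t)) ` ({a..b} \<times> {0..<1}) = closed_annulus a b"
proof (intro equalityI subsetI)
  fix z assume z: "z \<in> closed_annulus a b"
  have "z = of_real (norm z) * cis (2 * pi * (Arg2pi z / (2 * pi)))"
    using Arg2pi_eq[of z] by (simp add: cis_conv_exp)
  moreover have "norm z \<in> {a..b}" "Arg2pi z / (2 * pi) \<in> {0..<1}"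
    using z Arg2pi[of z] by (auto simp: closed_annulus_def)
  ultimately show "z \<in> (\<lambda>(r, t). of_real r * cis (2 * pi * t)) ` ({a..b} \<times> {0..<1})"
    by (intro image_eqI[of _ _ "(norm z, Arg2pi z / (2 * pi))"]) auto
qed (use assms in \<open>auto simp: closed_annulus_def norm_mult\<close>)

text \<open>
  The map \<open>(r, t) \<mapsto> f (r cis (2 \<pi> t))\<close> has Jacobian determinant \<open>2 \<pi> r |f'|\<^sup>2\<close> and is injective on
  \<open>[a, b] \<times> [0, 1)\<close>. The side \<open>t = 1\<close>, left out for injectivity, is a null set and is put back before
  the integral is iterated.
\<close>

lemma measure_holomorphic_image_annulus:
  assumes hol: "f holomorphic_on U" and U: "open U" and inj: "inj_on f (closed_annulus a b)"
    and sub: "closed_annulus a b \<subseteq> U" and ab: "0 < a" "a \<le> b"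
  shows "measure lebesgue (f ` closed_annulus a b) =
    integral {a..b} (\<lambda>r. integral {0..1} (\<lambda>t. 2 * pi * r * (norm (deriv f (of_real r * cis (2 * pi * t))))\<^sup>2))"
proof -
  define P where "P x = of_real (x $ 1) * cis (2 * pi * x $ 2)" for x :: "real^2"
  define F where "F x = vec_of_complex (f (P x))" for x
  define F' where "F' x h = vec_of_complex (deriv f (P x) *
      (of_real (h $ 1) * cis (2 * pi * x $ 2) + of_real (x $ 1) * (of_real (2 * pi * h $ 2) * (\<i> * cis (2 * pi * x $ 2)))))"
    for x h :: "real^2"
  define D where "D x = 2 * pi * x $ 1 * (norm (deriv f (P x)))\<^sup>2" for x
  let ?S = "vec_of_pair ` ({a..b} \<times> {0..<1})"
  let ?T = "vec_of_pair ` cbox (a, 0) (b, 1)"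
  have PT: "P x \<in> closed_annulus a b" if "x \<in> ?T" for x
    using that ab by (auto simp: P_def closed_annulus_def norm_mult)
  have ST: "?S \<subseteq> ?T" by auto
  have derP: "(P has_derivative (\<lambda>h. of_real (h $ 1) * cis (2 * pi * x $ 2) +
      of_real (x $ 1) * (of_real (2 * pi * h $ 2) * (\<i> * cis (2 * pi * x $ 2))))) (at x)" for x
    unfolding P_def
    by (auto intro!: derivative_eq_intros bounded_linear.has_derivative[OF bounded_linear_vec_nth] simp: fun_eq_iff algebra_simps scaleR_conv_of_real)
  have derF: "(F has_derivative F' x) (at x within X)" if "x \<in> ?T" for x X
  proof -
    have "(f has_derivative (*) (deriv f (P x))) (at (P x))"
      using holomorphic_derivI[OF hol U] PT[OF that] sub by (auto simp: has_field_derivative_def)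
    from has_derivative_compose[OF derP this]
    have "((\<lambda>x. f (P x)) has_derivative (\<lambda>h. deriv f (P x) * (of_real (h $ 1) * cis (2 * pi * x $ 2) +
      of_real (x $ 1) * (of_real (2 * pi * h $ 2) * (\<i> * cis (2 * pi * x $ 2)))))) (at x)" .
    moreover have "bounded_linear vec_of_complex"
      using linear_vec_of_complex linear_conv_bounded_linear by blast
    ultimately show ?thesis
      unfolding F_def F'_def by (auto intro: has_derivative_at_withinI bounded_linear.has_derivative)
  qed
  have det: "\<bar>det (matrix (F' x))\<bar> = D x" if "x \<in> ?T" for x
  proof -
    define u where "u = deriv f (P x) * cis (2 * pi * x $ 2)"
    have x1: "0 \<le> x $ 1" using that ab by auto
    have F': "F' x (axis 1 1) = vec_of_complex u" "F' x (axis 2 1) = vec_of_complex (of_real (2 * pi * x $ 1) * (\<i> * u))"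
      by (simp_all add: F'_def u_def axis_def mult_ac)
    have "det (matrix (F' x)) = 2 * pi * x $ 1 * ((Re u)\<^sup>2 + (Im u)\<^sup>2)"
      unfolding det_2 matrix_def by (simp add: F') (simp add: algebra_simps power2_eq_square)
    also have "(Re u)\<^sup>2 + (Im u)\<^sup>2 = (norm (deriv f (P x)))\<^sup>2"
      using cmod_power2[of u] by (simp add: u_def norm_mult)
    finally show ?thesis using x1 by (simp add: D_def abs_mult)
  qed
  have injF: "inj_on F ?S"
  proof (rule inj_onI)
    fix x y assume xy: "x \<in> ?S" "y \<in> ?S" "F x = F y"
    have "f (P x) = f (P y)" using xy(3) inj_vec_of_complex by (auto simp: F_def inj_def)
    then have P: "P x = P y" using inj PT ST xy(1,2) by (meson inj_onD subsetD)
    obtain p q where p: "x = vec_of_pair p" "p \<in> {a..b} \<times> {0..<1}" and q: "y = vec_of_pair q" "q \<in> {a..b} \<times> {0..<1}"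
      using xy by blast
    have "p = q"
      by (rule inj_onD[OF inj_on_polar]) (use P p q ab in \<open>auto simp: P_def case_prod_beta\<close>)
    then show "x = y" using p q by simp
  qed
  have contP: "continuous_on X P" for X
    using derP has_derivative_continuous continuous_at_imp_continuous_on by blast
  have contD: "continuous_on ?T D"
  proof -
    have "deriv f holomorphic_on U" using hol U by (rule holomorphic_deriv)
    then have "continuous_on U (deriv f)" by (rule holomorphic_on_imp_continuous_on)
    then have "continuous_on ?T (\<lambda>x. deriv f (P x))"
      by (rule continuous_on_compose2[OF _ contP]) (use PT sub in auto)
    then show ?thesis unfolding D_def by (intro continuous_intros)
  qed
  have DT: "(D has_integral integral (cbox (a, 0) (b, 1)) (D \<circ> vec_of_pair)) ?T"
    by (rule has_integral_vec_of_pair_image[OF contD])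
  have negl: "negligible {x::real^2. x $ 2 = 1}"
    using negligible_standard_hyperplane[of "axis 2 1 :: real^2" 1]
    by (simp add: inner_axis axis_in_Basis_iff)
  have S_eq: "?S = ?T - {x. x $ 2 = 1}"
  proof (intro equalityI subsetI)
    fix x assume "x \<in> ?T - {x. x $ 2 = 1}"
    then obtain r t where "x = vec_of_pair (r, t)" "r \<in> {a..b}" "t \<in> {0..1}" "t \<noteq> 1" by auto
    then show "x \<in> ?S" by (intro image_eqI[of _ _ "(r, t)"]) auto
  qed auto
  have DS: "(D has_integral integral (cbox (a, 0) (b, 1)) (D \<circ> vec_of_pair)) ?S"
  proof (rule has_integral_spike_set_eq[THEN iffD1, OF _ _ DT])
    show "negligible {x \<in> ?T - ?S. D x \<noteq> 0}"
      by (rule negligible_subset[OF negl]) (auto simp: S_eq)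
    show "negligible {x \<in> ?S - ?T. D x \<noteq> 0}"
      using ST by (auto simp: Diff_eq_empty_iff[THEN iffD2])
  qed
  have S: "?S \<in> sets lebesgue"
  proof -
    have "compact ?T"
      using compact_continuous_image[OF _ compact_cbox] linear_continuous_on linear_conv_bounded_linear linear_vec_of_pair by blast
    then have "?T \<in> sets lebesgue" by (simp add: lmeasurable_compact fmeasurableD)
    moreover have "{x::real^2. x $ 2 = 1} \<in> sets lebesgue"
      using negl by (simp add: negligible_imp_sets)
    ultimately show ?thesis unfolding S_eq by (rule sets.Diff)
  qed
  have "vec_of_complex ` f ` closed_annulus a b = F ` ?S"
    unfolding polar_image[OF ab(1), symmetric] by (simp add: image_image F_def P_def case_prod_beta)
  moreover have "compact (f ` closed_annulus a b)"
    using compact_closed_annulus holomorphic_on_imp_continuous_on[OF hol] sub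
    by (meson compact_continuous_image continuous_on_subset)
  ultimately have "measure lebesgue (f ` closed_annulus a b) = measure lebesgue (F ` ?S)"
    using measure_vec_of_complex_image by metis
  also have "\<dots> = integral ?S (\<lambda>x. \<bar>det (matrix (F' x))\<bar>)"
  proof (rule measure_differentiable_image_eq[OF S _ injF])
    show "(\<lambda>x. \<bar>det (matrix (F' x))\<bar>) integrable_on ?S"
      using DS integrable_cong[of ?S D] det ST by (metis (no_types, lifting) has_integral_integrable subsetD)
  qed (use derF ST in blast)
  also have "\<dots> = integral ?S D"
    by (rule integral_cong) (use det ST in blast)
  also have "\<dots> = integral (cbox (a, 0) (b, 1)) (D \<circ> vec_of_pair)"
    using DS by (rule integral_unique)
  also have "\<dots> = integral (cbox a b) (\<lambda>r. integral (cbox 0 1) (\<lambda>t. (D \<circ> vec_of_pair) (r, t)))"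
  proof (rule integral_prod_continuous)
    show "continuous_on (cbox (a, 0) (b, 1)) (D \<circ> vec_of_pair)"
      using contD linear_continuous_on linear_conv_bounded_linear linear_vec_of_pair
      by (blast intro: continuous_on_compose)
  qed
  finally show ?thesis by (simp add: D_def P_def o_def)
qed

section \<open>Maps of the form \<open>z + G (1 / z)\<close>\<close>

text \<open>
  This is the mean value property at \<open>0\<close>. The point \<open>1 / (r cis (2 \<pi> t))\<close> runs clockwise through the
  circle of radius \<open>1 / r\<close>, which the substitution \<open>t \<mapsto> 1 - t\<close> undoes.
\<close>

lemma has_integral_circle_reciprocal:
  assumes hol: "P holomorphic_on ball 0 \<rho>" and P0: "P 0 = 0" and r: "0 < r" "1 / r < \<rho>"
  shows "((\<lambda>t. P (inverse (of_real r * cis (2 * pi * t)))) has_integral 0) {0..1}"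
proof -
  have "((\<lambda>u. P u / (u - 0)) has_contour_integral (2 * of_real pi * \<i> * P 0)) (circlepath 0 (1 / r))"
    by (rule Cauchy_integral_circlepath_simple)
       (use r in \<open>auto intro!: holomorphic_on_subset[OF hol]\<close>)
  then have "((\<lambda>t. P (circlepath 0 (1 / r) t) / circlepath 0 (1 / r) t *
      vector_derivative (circlepath 0 (1 / r)) (at t within {0..1})) has_integral 0) {0..1}"
    using P0 by (simp add: has_contour_integral_def)
  then have "((\<lambda>t. (2 * pi * \<i>) * P (of_real (1 / r) * cis (2 * pi * t))) has_integral 0) {0..1}"
  proof (rule has_integral_eq[rotated])
    fix t :: real assume t: "t \<in> {0..1}"
    have c: "circlepath 0 (1 / r) t = of_real (1 / r) * cis (2 * pi * t)"
      by (simp add: circlepath cis_conv_exp mult_ac)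
    have v: "vector_derivative (circlepath 0 (1 / r)) (at t within {0..1}) =
        2 * pi * \<i> * (of_real (1 / r) * cis (2 * pi * t))"
      using t by (simp add: vector_derivative_circlepath01 cis_conv_exp mult_ac)
    have "of_real (1 / r) * cis (2 * pi * t) \<noteq> (0::complex)" using r by simp
    then show "P (circlepath 0 (1 / r) t) / circlepath 0 (1 / r) t *
        vector_derivative (circlepath 0 (1 / r)) (at t within {0..1}) =
        (2 * pi * \<i>) * P (of_real (1 / r) * cis (2 * pi * t))"
      unfolding c v by (simp add: field_simps)
  qed
  then have "((\<lambda>t. inverse (2 * pi * \<i>) * ((2 * pi * \<i>) * P (of_real (1 / r) * cis (2 * pi * t)))) has_integral
      inverse (2 * pi * \<i>) * 0) {0..1}"
    by (rule has_integral_mult_right)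
  then have "((\<lambda>t. P (of_real (1 / r) * cis (2 * pi * t))) has_integral 0) {0..1}"
    by (simp add: field_simps)
  from has_integral_affinity01[OF this, of "-1" 1]
  have "((\<lambda>t. P (of_real (1 / r) * cis (2 * pi * (1 - t)))) has_integral 0) ((\<lambda>x. 1 - x) ` {0..1})"
    by (simp add: algebra_simps)
  moreover have "(\<lambda>x. 1 - x) ` {0..1} = {0..1::real}"
    using image_affinity_atLeastAtMost_diff[of "-1"] by (auto simp: image_iff intro!: bexI[of _ "1 - _"])
  moreover have "of_real (1 / r) * cis (2 * pi * (1 - t)) = inverse (of_real r * cis (2 * pi * t))" for t
  proof -
    have "2 * pi * (1 - t) = 2 * pi + - (2 * pi * t)" by (simp add: algebra_simps)
    then have "cis (2 * pi * (1 - t)) = inverse (cis (2 * pi * t))"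
      by (simp only: cis_mult[symmetric]) (simp add: cis_inverse)
    then show ?thesis by (simp add: inverse_eq_divide)
  qed
  ultimately show ?thesis by simp
qed

lemma has_integral_ring_area:
  assumes "0 < a" "a \<le> b"
  shows "((\<lambda>r. 2 * pi * r * (1 + \<mu>\<^sup>2 / r ^ 4)) has_integral
     pi * (b\<^sup>2 - a\<^sup>2) + pi * \<mu>\<^sup>2 * (1 / a\<^sup>2 - 1 / b\<^sup>2)) {a..b}"
proof -
  have "((\<lambda>r. pi * r\<^sup>2 - pi * \<mu>\<^sup>2 * (1 / r\<^sup>2)) has_vector_derivative 2 * pi * r * (1 + \<mu>\<^sup>2 / r ^ 4)) (at r within {a..b})"
    if "r \<in> {a..b}" for r
  proof -
    have "r > 0" using that assms by simp
    then show ?thesis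
      unfolding has_real_derivative_iff_has_vector_derivative[symmetric]
      by (auto intro!: derivative_eq_intros simp: field_simps power2_eq_square power4_eq_xxxx)
  qed
  from fundamental_theorem_of_calculus[OF assms(2) this] show ?thesis
    by (simp add: algebra_simps)
qed

lemma deriv_plus_reciprocal:
  assumes hol: "G holomorphic_on ball 0 \<rho>" and z: "z \<noteq> 0" "norm (inverse z) < \<rho>"
  shows "((\<lambda>z. z + G (inverse z)) has_field_derivative 1 - deriv G (inverse z) * (inverse z)\<^sup>2) (at z)"
proof -
  have "(G has_field_derivative deriv G (inverse z)) (at (inverse z))"
    using hol z by (intro holomorphic_derivI) auto
  moreover have "(inverse has_field_derivative - (inverse z)\<^sup>2) (at z)"
    using DERIV_inverse[OF z(1), of UNIV] by (simp add: power2_eq_square)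
  ultimately show ?thesis
    by (auto intro!: derivative_eq_intros DERIV_chain2[of G])
qed

text \<open>
  Write \<open>P w = w\<^sup>2 G' w\<close>, so that the derivative of \<open>z + G (1 / z)\<close> is \<open>1 - P (1 / z)\<close>. In
  \<open>|1 - P|\<^sup>2 = 1 - 2 Re P + |P|\<^sup>2\<close> the middle term has mean zero over each circle because \<open>P 0 = 0\<close>,
  and \<open>|P|\<^sup>2 = |G'|\<^sup>2 / r\<^sup>4\<close> over the circle of radius \<open>r\<close>.
\<close>

lemma measure_image_annulus_reciprocal:
  assumes hol: "G holomorphic_on ball 0 \<rho>" and ab: "0 < a" "a \<le> b" "1 / a < \<rho>"
    and inj: "inj_on (\<lambda>z. z + G (inverse z)) (closed_annulus a b)"
  shows "((\<lambda>r. 2 * pi * r * (1 + integral {0..1} (\<lambda>t. (norm (deriv G (inverse (of_real r * cis (2 * pi * t)))))\<^sup>2) / r ^ 4))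
     has_integral measure lebesgue ((\<lambda>z. z + G (inverse z)) ` closed_annulus a b)) {a..b}"
proof -
  let ?f = "\<lambda>z. z + G (inverse z)"
  define Q where "Q r t = norm (deriv G (inverse (of_real r * cis (2 * pi * t))))" for r t
  define U where "U = -{0::complex} \<inter> inverse -` ball 0 \<rho>"
  have "open U"
    unfolding U_def using continuous_on_inverse[OF continuous_on_id, of "-{0::complex}"]
    by (intro continuous_open_preimage) auto
  have sub: "closed_annulus a b \<subseteq> U"
  proof
    fix z assume "z \<in> closed_annulus a b"
    then have "a \<le> norm z" by (simp add: closed_annulus_def)
    then have "norm (inverse z) \<le> 1 / a"
      using ab le_imp_inverse_le[of a "norm z"] by (simp add: norm_inverse divide_inverse)
    with \<open>a \<le> norm z\<close> ab show "z \<in> U" by (auto simp: U_def)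
  qed
  have der: "(?f has_field_derivative 1 - deriv G (inverse z) * (inverse z)\<^sup>2) (at z)" if "z \<in> U" for z
    using that by (intro deriv_plus_reciprocal[OF hol]) (auto simp: U_def)
  have "?f holomorphic_on U"
    using der \<open>open U\<close> holomorphic_on_open by blast
  from measure_holomorphic_image_annulus[OF this \<open>open U\<close> inj sub ab(1,2)]
  have meas: "measure lebesgue (?f ` closed_annulus a b) =
    integral {a..b} (\<lambda>r. integral {0..1} (\<lambda>t. 2 * pi * r * (norm (deriv ?f (of_real r * cis (2 * pi * t))))\<^sup>2))" .
  have holG': "deriv G holomorphic_on ball 0 \<rho>" using hol by (rule holomorphic_deriv) simp
  have inv_in: "inverse (of_real r * cis (2 * pi * t)) \<in> ball 0 \<rho>" if "r \<in> {a..b}" for r t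
  proof -
    have "of_real r * cis (2 * pi * t) \<in> closed_annulus a b"
      using that ab by (simp add: closed_annulus_def norm_mult)
    then show ?thesis using sub by (auto simp: U_def)
  qed
  have contQ: "continuous_on ({a..b} \<times> {0..1}) (\<lambda>(r, t). (Q r t)\<^sup>2)"
  proof -
    have "continuous_on ({a..b} \<times> {0..1}) (\<lambda>x. deriv G (inverse (of_real (fst x) * cis (2 * pi * snd x))))"
      by (rule continuous_on_compose2[OF holomorphic_on_imp_continuous_on[OF holG']])
         (use ab inv_in in \<open>auto intro!: continuous_intros\<close>)
    then show ?thesis unfolding Q_def by (auto intro!: continuous_intros simp: case_prod_beta)
  qed
  have inner: "integral {0..1} (\<lambda>t. 2 * pi * r * (norm (deriv ?f (of_real r * cis (2 * pi * t))))\<^sup>2) =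
      2 * pi * r * (1 + integral {0..1} (\<lambda>t. (Q r t)\<^sup>2) / r ^ 4)" if r: "r \<in> {a..b}" for r
  proof -
    define z where "z t = of_real r * cis (2 * pi * t)" for t
    define P where "P w = deriv G w * w\<^sup>2" for w
    have r0: "0 < r" using r ab by simp
    have nz: "norm (z t) = r" for t using r0 by (simp add: z_def norm_mult)
    have "1 / r \<le> 1 / a" using r ab by (simp add: frac_le)
    then have "((\<lambda>t. P (inverse (z t))) has_integral 0) {0..1}"
      unfolding z_def using holG' ab r0
      by (intro has_integral_circle_reciprocal[of _ \<rho>]) (auto simp: P_def intro!: holomorphic_intros)
    from has_integral_linear[OF this bounded_linear_Re]
    have "((\<lambda>t. Re (P (inverse (z t)))) has_integral 0) {0..1}" by (simp add: o_def)
    then have i1: "((\<lambda>t. 1 - 2 * Re (P (inverse (z t)))) has_integral 1 - 2 * 0) {0..1}"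
      using has_integral_const_real[of "1::real" 0 1]
      by (intro has_integral_diff has_integral_mult_right) auto
    have "continuous_on {0..1} (\<lambda>t. (Q r t)\<^sup>2)"
    proof -
      have "continuous_on {0..1} (\<lambda>t. (\<lambda>(r, t). (Q r t)\<^sup>2) (r, t))"
        by (rule continuous_on_compose2[OF contQ]) (use r in \<open>auto intro!: continuous_intros\<close>)
      then show ?thesis by simp
    qed
    then have "(\<lambda>t. (Q r t)\<^sup>2) integrable_on {0..1}"
      by (rule integrable_continuous_real)
    then have "((\<lambda>t. (Q r t)\<^sup>2 / r ^ 4) has_integral integral {0..1} (\<lambda>t. (Q r t)\<^sup>2) / r ^ 4) {0..1}"
      using has_integral_divide[OF integrable_integral] by blast
    from has_integral_add[OF i1 this]
    have i2: "((\<lambda>t. 1 - 2 * Re (P (inverse (z t))) + (Q r t)\<^sup>2 / r ^ 4) has_integral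
       1 + integral {0..1} (\<lambda>t. (Q r t)\<^sup>2) / r ^ 4) {0..1}" by simp
    have "(norm (deriv ?f (z t)))\<^sup>2 = 1 - 2 * Re (P (inverse (z t))) + (Q r t)\<^sup>2 / r ^ 4" for t
    proof -
      have "z t \<in> U" using sub r nz by (auto simp: closed_annulus_def)
      then have "deriv ?f (z t) = 1 - P (inverse (z t))"
        using der DERIV_imp_deriv unfolding P_def by blast
      moreover have "(norm (1 - p))\<^sup>2 = 1 - 2 * Re p + (norm p)\<^sup>2" for p :: complex
        unfolding cmod_power2 by (simp add: power2_eq_square algebra_simps)
      moreover have "(norm (P (inverse (z t))))\<^sup>2 = (Q r t)\<^sup>2 / r ^ 4"
      proof -
        have "norm (P (inverse (z t))) = Q r t * (inverse r)\<^sup>2"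
          unfolding Q_def z_def[symmetric] P_def by (simp only: norm_mult norm_power norm_inverse nz)
        then show ?thesis
          by (simp add: power_mult_distrib divide_inverse power_inverse flip: power_mult)
      qed
      ultimately show ?thesis by simp
    qed
    then have "integral {0..1} (\<lambda>t. (norm (deriv ?f (z t)))\<^sup>2) = 1 + integral {0..1} (\<lambda>t. (Q r t)\<^sup>2) / r ^ 4"
      using integral_unique[OF i2] by simp
    then show ?thesis unfolding z_def by simp
  qed
  have "continuous_on {a..b} (\<lambda>r. integral (cbox 0 1) (\<lambda>t. (Q r t)\<^sup>2))"
    by (rule integral_continuous_on_param) (use contQ in simp)
  then have "(\<lambda>r. 2 * pi * r * (1 + integral {0..1} (\<lambda>t. (Q r t)\<^sup>2) / r ^ 4)) integrable_on {a..b}"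
    using ab by (intro integrable_continuous_real continuous_intros) auto
  moreover have "integral {a..b} (\<lambda>r. 2 * pi * r * (1 + integral {0..1} (\<lambda>t. (Q r t)\<^sup>2) / r ^ 4)) =
      measure lebesgue (?f ` closed_annulus a b)"
    unfolding meas by (rule integral_cong) (rule inner[symmetric])
  ultimately show ?thesis
    unfolding Q_def[symmetric] by (simp add: has_integral_iff)
qed

lemma measure_image_annulus_le:
  assumes hol: "G holomorphic_on ball 0 \<rho>" and ab: "0 < a" "a \<le> b" "1 / a < \<rho>"
    and inj: "inj_on (\<lambda>z. z + G (inverse z)) (closed_annulus a b)"
    and bound: "\<And>w. norm w \<le> 1 / a \<Longrightarrow> norm (deriv G w) \<le> \<mu>"
  shows "measure lebesgue ((\<lambda>z. z + G (inverse z)) ` closed_annulus a b) \<le>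
     pi * (b\<^sup>2 - a\<^sup>2) + pi * \<mu>\<^sup>2 * (1 / a\<^sup>2 - 1 / b\<^sup>2)"
proof (rule has_integral_le[OF measure_image_annulus_reciprocal[OF hol ab inj] has_integral_ring_area[OF ab(1,2)]])
  fix r assume r: "r \<in> {a..b}"
  let ?w = "\<lambda>t. inverse (of_real r * cis (2 * pi * t))"
  have r0: "0 < r" using r ab by simp
  have w: "norm (?w t) \<le> 1 / a" for t
  proof -
    have "norm (?w t) = 1 / r" using r0 by (simp only: norm_inverse norm_mult) (simp add: inverse_eq_divide)
    then show ?thesis using r ab by (simp add: frac_le)
  qed
  have w_ball: "?w ` {0..1} \<subseteq> ball 0 \<rho>"
    using le_less_trans[OF w ab(3)] by (simp only: image_subset_iff mem_ball_0) blast
  have "continuous_on {0..1} (\<lambda>t. deriv G (?w t))"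
    by (rule continuous_on_compose2[OF holomorphic_on_imp_continuous_on[OF holomorphic_deriv[OF hol]] _ w_ball])
       (use r0 in \<open>auto intro!: continuous_intros\<close>)
  then have "(\<lambda>t. (norm (deriv G (?w t)))\<^sup>2) integrable_on {0..1}"
    by (intro integrable_continuous_real continuous_intros)
  then have "integral {0..1} (\<lambda>t. (norm (deriv G (?w t)))\<^sup>2) \<le> integral {0..1} (\<lambda>t::real. \<mu>\<^sup>2)"
  proof (rule integral_le)
    show "(norm (deriv G (?w t)))\<^sup>2 \<le> \<mu>\<^sup>2" for t
      using bound[OF w] by (rule power_mono) simp
  qed (simp_all add: integrable_const_ivl)
  then show "2 * pi * r * (1 + integral {0..1} (\<lambda>t. (norm (deriv G (?w t)))\<^sup>2) / r ^ 4)
      \<le> 2 * pi * r * (1 + \<mu>\<^sup>2 / r ^ 4)"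
    using r0 by (intro mult_left_mono add_left_mono divide_right_mono) auto
qed

text \<open>
  For \<open>G w = \<beta> w\<close> the integrand is constant on circles, which turns the estimate into an identity.
\<close>

lemma measure_joukowski_image_annulus:
  fixes \<beta> :: complex
  assumes ab: "0 < a" "a \<le> b" and inj: "inj_on (\<lambda>z. z + \<beta> * inverse z) (closed_annulus a b)"
  shows "measure lebesgue ((\<lambda>z. z + \<beta> * inverse z) ` closed_annulus a b) =
     pi * (b\<^sup>2 - a\<^sup>2) + pi * (norm \<beta>)\<^sup>2 * (1 / a\<^sup>2 - 1 / b\<^sup>2)"
proof -
  have "deriv (\<lambda>w. \<beta> * w) w = \<beta>" for w
    by (rule DERIV_imp_deriv) (auto intro!: derivative_eq_intros)
  moreover have "(*) \<beta> holomorphic_on ball 0 (1 / a + 1)"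
    by (auto intro!: holomorphic_intros)
  ultimately have "((\<lambda>r. 2 * pi * r * (1 + (norm \<beta>)\<^sup>2 / r ^ 4)) has_integral
      measure lebesgue ((\<lambda>z. z + \<beta> * inverse z) ` closed_annulus a b)) {a..b}"
    using measure_image_annulus_reciprocal[of "(*) \<beta>" "1 / a + 1" a b] ab inj by simp
  then show ?thesis
    using has_integral_ring_area[OF ab, of "norm \<beta>"] by (rule has_integral_unique)
qed

section \<open>The bound for \<open>G'\<close>\<close>

lemma open_ext_disc: "open ext_disc"
proof -
  have "ext_disc = - cball 0 1" by (auto simp: ext_disc_def)
  then show ?thesis by (metis closed_cball open_Compl)
qed

lemma inverse_mem_ext_disc: "w \<noteq> 0 \<Longrightarrow> norm w < 1 \<Longrightarrow> inverse w \<in> ext_disc"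
  by (simp add: ext_disc_def norm_inverse one_less_inverse)

lemma inverse_ext_disc: "z \<in> ext_disc \<Longrightarrow> z \<noteq> 0 \<and> norm (inverse z) < 1"
  by (auto simp: ext_disc_def norm_inverse inverse_less_1_iff)

text \<open>
  The hypothesis on \<open>g'\<close> only gives \<open>|G' u| < l / \<rho>\<^sup>2\<close> on the circle \<open>|u| = \<rho>\<close>; by the maximum principle
  this holds on the whole disc of radius \<open>\<rho>\<close>, and \<open>\<rho>\<close> tends to \<open>1\<close>.
\<close>

lemma class_M0_obtain_reciprocal:
  assumes "g \<in> class_M0 l"
  obtains G where "G holomorphic_on ball 0 1" "G 0 = 0"
    "\<And>z. z \<in> ext_disc \<Longrightarrow> g z = z + G (inverse z)"
    "\<And>w. norm w < 1 \<Longrightarrow> norm (deriv G w) \<le> l"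
proof -
  have gM: "norm (deriv g z - 1) < l" if "z \<in> ext_disc" for z
    using assms that by (auto simp: class_M0_def class_M_def)
  obtain b where b: "has_expansion g b"
    using assms by (auto simp: class_M0_def class_M_def class_Sigma_def)
  have b_0: "b 0 = 0" using assms b0_eq[OF b] by (simp add: class_M0_def)
  define G where "G w = (if w = 0 then 0 else g (inverse w) - inverse w)" for w
  have sums: "(\<lambda>n. b n * (w - 0) ^ n) sums G w" if "w \<in> ball 0 1" for w
  proof (cases "w = 0")
    case True
    then show ?thesis using powser_sums_zero[of b] b_0 by (simp add: G_def)
  next
    case False
    then have "(\<lambda>n. b n / inverse w ^ n) sums (g (inverse w) - inverse w)"
      using b that inverse_mem_ext_disc[of w] by (auto simp: has_expansion_def)
    then show ?thesis using False by (simp add: G_def field_simps power_inverse)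
  qed
  have hol: "G holomorphic_on ball 0 1"
    using sums by (rule power_series_holomorphic)
  have G0: "G 0 = 0" by (simp add: G_def)
  have rep: "g z = z + G (inverse z)" if "z \<in> ext_disc" for z
    using inverse_ext_disc[OF that] by (simp add: G_def)
  have dg: "deriv g z = 1 - deriv G (inverse z) * (inverse z)\<^sup>2" if z: "z \<in> ext_disc" for z
  proof -
    have "((\<lambda>z. z + G (inverse z)) has_field_derivative 1 - deriv G (inverse z) * (inverse z)\<^sup>2) (at z)"
      using inverse_ext_disc[OF z] by (intro deriv_plus_reciprocal[OF hol]) auto
    then have "(g has_field_derivative 1 - deriv G (inverse z) * (inverse z)\<^sup>2) (at z)"
      by (rule has_field_derivative_transform_within_open[OF _ open_ext_disc z]) (simp add: rep)
    then show ?thesis by (rule DERIV_imp_deriv)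
  qed
  have holG': "deriv G holomorphic_on ball 0 1" using hol by (rule holomorphic_deriv) simp
  have sphere: "norm (deriv G u) \<le> l / \<rho>\<^sup>2" if u: "norm u = \<rho>" and \<rho>: "0 < \<rho>" "\<rho> < 1" for u \<rho>
  proof -
    have "inverse u \<in> ext_disc" using u \<rho> by (intro inverse_mem_ext_disc) auto
    from gM[OF this] dg[OF this] have "norm (deriv G u * u\<^sup>2) < l" by simp
    then show ?thesis using u \<rho> by (simp add: norm_mult norm_power field_simps)
  qed
  have bound: "norm (deriv G w) \<le> l" if w: "norm w < 1" for w
  proof (rule field_le_mult_one_interval)
    fix x :: real assume x: "0 < x" "x < 1"
    \<comment> \<open>a radius beyond \<open>|w|\<close> that is close enough to \<open>1\<close> for \<open>x \<le> \<rho>\<^sup>2\<close>\<close>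
    define \<rho> where "\<rho> = max (sqrt x) ((1 + norm w) / 2)"
    have \<rho>: "0 < \<rho>" "\<rho> < 1" "norm w < \<rho>"
      using x w by (auto simp: \<rho>_def less_max_iff_disj real_sqrt_lt_1_iff)
    have "(sqrt x)\<^sup>2 \<le> \<rho>\<^sup>2" using x by (intro power_mono) (auto simp: \<rho>_def)
    then have x\<rho>: "x \<le> \<rho>\<^sup>2" using x by simp
    have "norm (deriv G w) \<le> l / \<rho>\<^sup>2"
    proof (rule maximum_modulus_frontier[of "deriv G" "ball 0 \<rho>"])
      show "deriv G holomorphic_on interior (ball 0 \<rho>)"
        using \<rho> by (auto intro: holomorphic_on_subset[OF holG'])
      show "continuous_on (closure (ball 0 \<rho>)) (deriv G)"
        using \<rho> by (intro holomorphic_on_imp_continuous_on holomorphic_on_subset[OF holG']) auto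
    qed (use \<rho> sphere in auto)
    then have "\<rho>\<^sup>2 * norm (deriv G w) \<le> l" using \<rho> by (simp add: field_simps)
    moreover have "x * norm (deriv G w) \<le> \<rho>\<^sup>2 * norm (deriv G w)"
      using x\<rho> by (rule mult_right_mono) simp
    ultimately show "x * norm (deriv G w) \<le> l" by simp
  qed
  show thesis by (rule that[OF hol G0 rep bound])
qed

section \<open>Comparison with a Joukowski map near infinity\<close>

lemma second_order_bound:
  assumes hol: "G holomorphic_on ball 0 1" and G0: "G 0 = 0"
  obtains C where "0 \<le> C" "\<And>w. norm w \<le> 1 / 2 \<Longrightarrow> norm (G w - deriv G 0 * w) \<le> C * (norm w)\<^sup>2"
proof -
  obtain h where h: "h holomorphic_on ball 0 1" "\<And>w. norm w < 1 \<Longrightarrow> G w = w * h w" "deriv G 0 = h 0"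
    using Schwarz3[OF hol G0] by metis
  have "(\<lambda>w. h w - h 0) holomorphic_on ball 0 1" using h(1) by (intro holomorphic_intros)
  then obtain k where k: "k holomorphic_on ball 0 1" "\<And>w. norm w < 1 \<Longrightarrow> h w - h 0 = w * k w"
    using Schwarz3[of "\<lambda>w. h w - h 0" 1] by (metis diff_self)
  have "continuous_on (cball 0 (1/2)) k"
    by (intro holomorphic_on_imp_continuous_on holomorphic_on_subset[OF k(1)]) auto
  then have "bounded (k ` cball 0 (1/2))"
    by (intro compact_imp_bounded compact_continuous_image) auto
  then obtain C where C: "\<forall>x\<in>k ` cball 0 (1/2). norm x \<le> C" by (auto simp: bounded_iff)
  show thesis
  proof (rule that[of "max C 0"])
    fix w :: complex assume w: "norm w \<le> 1/2"
    then have "G w - deriv G 0 * w = w * (h w - h 0)" using h by (simp add: algebra_simps)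
    also have "\<dots> = k w * w\<^sup>2" using k(2)[of w] w by (simp add: power2_eq_square)
    finally show "norm (G w - deriv G 0 * w) \<le> max C 0 * (norm w)\<^sup>2"
      using C w by (auto simp: norm_mult norm_power le_max_iff_disj intro!: mult_right_mono)
  qed simp
qed

lemma joukowski_diff:
  fixes z \<zeta> \<beta> :: complex
  assumes "z \<noteq> 0" "\<zeta> \<noteq> 0"
  shows "(z + \<beta> * inverse z) - (\<zeta> + \<beta> * inverse \<zeta>) = (z - \<zeta>) * (1 - \<beta> / (z * \<zeta>))"
  using assms by (simp add: field_simps)

lemma inj_on_joukowski:
  fixes \<beta> :: complex
  assumes "0 < a" "norm \<beta> < a\<^sup>2"
  shows "inj_on (\<lambda>z. z + \<beta> * inverse z) (closed_annulus a b)"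
proof (rule inj_onI)
  fix z \<zeta> assume z: "z \<in> closed_annulus a b" and \<zeta>: "\<zeta> \<in> closed_annulus a b"
    and eq: "z + \<beta> * inverse z = \<zeta> + \<beta> * inverse \<zeta>"
  have az: "a \<le> norm z" "a \<le> norm \<zeta>" using z \<zeta> by (auto simp: closed_annulus_def)
  have nz: "z \<noteq> 0" "\<zeta> \<noteq> 0" using az assms by auto
  have "norm \<beta> < norm z * norm \<zeta>"
    using assms mult_mono[OF az] by (simp add: power2_eq_square)
  then have "\<beta> \<noteq> z * \<zeta>" by (auto simp: norm_mult)
  then have "1 - \<beta> / (z * \<zeta>) \<noteq> 0" using nz by (simp add: field_simps)
  moreover have "(z - \<zeta>) * (1 - \<beta> / (z * \<zeta>)) = 0"
    unfolding joukowski_diff[OF nz, symmetric] using eq by simp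
  ultimately show "z = \<zeta>" by (metis mult_eq_0_iff right_minus_eq)
qed

text \<open>
  On \<open>|\<zeta>| \<ge> R\<close> the map \<open>\<zeta> + G (1 / \<zeta>)\<close> differs from \<open>J \<zeta> = \<zeta> + \<beta> / \<zeta>\<close> by at most \<open>C / R\<^sup>2\<close>, whereas
  \<open>|J z - J \<zeta>| = |z - \<zeta>| |1 - \<beta> / (z \<zeta>)|\<close> is at least half of the gap \<open>|\<zeta>| - |z|\<close>. A gap of more than
  \<open>2 C / R\<^sup>2\<close> thus keeps the two images apart. The gap has to be this small: shrinking the radius
  \<open>R\<close> by a multiple of \<open>1 / R\<close> would lose an area that does not tend to zero.
\<close>

lemma joukowski_image_disjoint:
  fixes z \<zeta> \<beta> :: complex
  assumes C: "\<And>w. norm w \<le> 1 / 2 \<Longrightarrow> norm (G w - \<beta> * w) \<le> C * (norm w)\<^sup>2" "0 \<le> C"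
    and \<beta>: "norm \<beta> \<le> 1" and R: "2 \<le> R"
    and z: "0 < norm z" "norm \<beta> \<le> (norm z)\<^sup>2" "norm z \<le> R - (2 * C + 1) / R\<^sup>2"
    and \<zeta>: "R \<le> norm \<zeta>"
  shows "z + \<beta> * inverse z \<noteq> \<zeta> + G (inverse \<zeta>)"
proof
  assume eq: "z + \<beta> * inverse z = \<zeta> + G (inverse \<zeta>)"
  have nz: "z \<noteq> 0" "\<zeta> \<noteq> 0" using z \<zeta> R by auto
  have w: "norm (inverse \<zeta>) \<le> 1 / R" using le_imp_inverse_le[OF \<zeta>] R by (simp add: norm_inverse divide_inverse)
  also have "1 / R \<le> 1 / 2" using R by (simp add: frac_le)
  finally have "norm (G (inverse \<zeta>) - \<beta> * inverse \<zeta>) \<le> C * (norm (inverse \<zeta>))\<^sup>2" by (rule C(1))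
  also have "\<dots> \<le> C * (1 / R)\<^sup>2" using w C(2) by (intro mult_left_mono power_mono) auto
  finally have k: "norm (G (inverse \<zeta>) - \<beta> * inverse \<zeta>) \<le> C / R\<^sup>2" by (simp add: power_divide)
  have "norm \<beta> \<le> norm z"
  proof (cases "norm z \<le> 1")
    case True
    then have "(norm z)\<^sup>2 \<le> norm z" by (simp add: power2_eq_square mult_left_le)
    then show ?thesis using z by simp
  qed (use \<beta> in simp)
  then have "norm \<beta> * 2 \<le> norm z * norm \<zeta>" using \<zeta> R by (intro mult_mono) auto
  then have "norm (\<beta> / (z * \<zeta>)) \<le> 1 / 2"
    using nz by (simp add: norm_divide norm_mult field_simps)
  then have "1 / 2 \<le> norm (1 - \<beta> / (z * \<zeta>))"
    using norm_triangle_ineq2[of 1 "\<beta> / (z * \<zeta>)"] by simp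
  then have "norm (z - \<zeta>) * (1 / 2) \<le> norm (z - \<zeta>) * norm (1 - \<beta> / (z * \<zeta>))"
    by (rule mult_left_mono) simp
  also have "\<dots> = norm (G (inverse \<zeta>) - \<beta> * inverse \<zeta>)"
    unfolding norm_mult[symmetric] joukowski_diff[OF nz, symmetric] using eq by (simp add: algebra_simps)
  finally have "norm (z - \<zeta>) \<le> 2 * C / R\<^sup>2" using k by simp
  moreover have "(2 * C + 1) / R\<^sup>2 \<le> norm (z - \<zeta>)"
    using z(3) \<zeta> norm_triangle_ineq2[of \<zeta> z] by (simp add: norm_minus_commute)
  moreover have "2 * C / R\<^sup>2 < (2 * C + 1) / R\<^sup>2" using R by (intro divide_strict_right_mono) auto
  ultimately show False by linarith
qed

section \<open>The area of the omitted set\<close>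

text \<open>
  The set \<open>A\<close> is the image of \<open>1 < |\<zeta>| \<le> R\<close>, exhausted from inside because \<open>G\<close> is only controlled on
  the open disc; the inner radii \<open>1 + 1 / (n + 2)\<close> lie strictly between \<open>1\<close> and \<open>2\<close>. The circle
  \<open>|\<zeta>| = 2\<close> separates the part where \<open>|G'| \<le> l\<close> is used from the part where \<open>|1 / \<zeta>| \<le> 1/2\<close> and
  the bound \<open>\<mu>\<close> is available. The two parts contribute \<open>3/4 l\<^sup>2\<close> and \<open>1/4 \<mu>\<^sup>2\<close>.
\<close>

lemma emeasure_image_exterior_annulus_le:
  assumes hol: "G holomorphic_on ball 0 1"
    and inj: "inj_on (\<lambda>z. z + G (inverse z)) ext_disc"
    and l: "\<And>w. norm w < 1 \<Longrightarrow> norm (deriv G w) \<le> l"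
    and \<mu>: "\<And>w. norm w \<le> 1 / 2 \<Longrightarrow> norm (deriv G w) \<le> \<mu>" and R: "2 \<le> R"
  defines "A \<equiv> (\<Union>n. (\<lambda>z. z + G (inverse z)) ` closed_annulus (1 + 1 / real (Suc (Suc n))) R)"
  shows "A \<in> sets lebesgue"
    and "emeasure lebesgue A \<le> ennreal (pi * (R\<^sup>2 - 1 + 3 / 4 * l\<^sup>2 + 1 / 4 * \<mu>\<^sup>2))"
proof -
  let ?f = "\<lambda>z. z + G (inverse z)"
  define r where "r n = 1 + 1 / real (Suc (Suc n))" for n
  define M where "M n = ?f ` closed_annulus (r n) R" for n
  have r: "1 < r n" "r n < 2" for n by (simp_all add: r_def)
  have ext: "closed_annulus a b \<subseteq> ext_disc" if "1 < a" for a b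
    using that by (auto simp: closed_annulus_def ext_disc_def)
  have cont: "continuous_on ext_disc ?f"
    using inverse_ext_disc
    by (intro continuous_intros continuous_on_compose2[OF holomorphic_on_imp_continuous_on[OF hol]]) auto
  have comp: "compact (?f ` closed_annulus a b)" if "1 < a" for a b
    using compact_continuous_image compact_closed_annulus continuous_on_subset[OF cont ext[OF that]] by blast
  have lm: "?f ` closed_annulus a b \<in> lmeasurable" if "1 < a" for a b
    using comp[OF that] by (rule lmeasurable_compact)
  have injA: "inj_on ?f (closed_annulus a b)" if "1 < a" for a b
    using inj ext[OF that] by (rule inj_on_subset)
  have M_sets: "M n \<in> sets lebesgue" for n
    using lm[OF r(1)] by (auto simp: M_def fmeasurableD)
  have A: "A = (\<Union>n. M n)" by (simp add: A_def M_def r_def)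
  show "A \<in> sets lebesgue" unfolding A using M_sets by blast
  have inc: "incseq M"
    unfolding incseq_def M_def
  proof (intro allI impI image_mono)
    fix m n :: nat assume "m \<le> n"
    then have "r n \<le> r m" unfolding r_def by (intro add_left_mono frac_le) auto
    then show "closed_annulus (r m) R \<subseteq> closed_annulus (r n) R" by (auto simp: closed_annulus_def)
  qed
  let ?B = "pi * (R\<^sup>2 - 1 + 3 / 4 * l\<^sup>2 + 1 / 4 * \<mu>\<^sup>2)"
  have "emeasure lebesgue (M n) \<le> ennreal ?B" for n
  proof -
    have inv: "1 / r n < 1" using r[of n] by simp
    have "M n \<subseteq> ?f ` closed_annulus (r n) 2 \<union> ?f ` closed_annulus 2 R"
      unfolding M_def image_Un[symmetric] by (intro image_mono) (auto simp: closed_annulus_def)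
    then have "measure lebesgue (M n) \<le> measure lebesgue (?f ` closed_annulus (r n) 2 \<union> ?f ` closed_annulus 2 R)"
      using lm[OF r(1)] lm[of 2] M_sets by (intro measure_mono_fmeasurable) auto
    also have "\<dots> \<le> measure lebesgue (?f ` closed_annulus (r n) 2) + measure lebesgue (?f ` closed_annulus 2 R)"
      using lm[OF r(1)] lm[of 2] by (intro measure_Un_le) (auto simp: fmeasurableD)
    also have "\<dots> \<le> (pi * (2\<^sup>2 - (r n)\<^sup>2) + pi * l\<^sup>2 * (1 / (r n)\<^sup>2 - 1 / 2\<^sup>2)) +
        (pi * (R\<^sup>2 - 2\<^sup>2) + pi * \<mu>\<^sup>2 * (1 / 2\<^sup>2 - 1 / R\<^sup>2))"
    proof (rule add_mono)
      show "measure lebesgue (?f ` closed_annulus (r n) 2) \<le>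
          pi * (2\<^sup>2 - (r n)\<^sup>2) + pi * l\<^sup>2 * (1 / (r n)\<^sup>2 - 1 / 2\<^sup>2)"
        using r[of n] inv injA by (intro measure_image_annulus_le[OF hol] l le_less_trans[OF _ inv]) auto
      show "measure lebesgue (?f ` closed_annulus 2 R) \<le> pi * (R\<^sup>2 - 2\<^sup>2) + pi * \<mu>\<^sup>2 * (1 / 2\<^sup>2 - 1 / R\<^sup>2)"
        by (rule measure_image_annulus_le[OF hol]) (use R injA in \<open>auto intro: \<mu>\<close>)
    qed
    also have "\<dots> \<le> ?B"
    proof -
      have "1 \<le> (r n)\<^sup>2" using r[of n] by (simp add: one_le_power)
      define u where "u = l\<^sup>2 / (r n)\<^sup>2"
      define v where "v = \<mu>\<^sup>2 / R\<^sup>2"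
      have "u \<le> l\<^sup>2 / 1" unfolding u_def using \<open>1 \<le> (r n)\<^sup>2\<close> by (intro divide_left_mono) auto
      moreover have "0 \<le> v" by (simp add: v_def)
      ultimately have "R\<^sup>2 - (r n)\<^sup>2 + (u - l\<^sup>2 / 4) + (\<mu>\<^sup>2 / 4 - v) \<le> R\<^sup>2 - 1 + 3 / 4 * l\<^sup>2 + 1 / 4 * \<mu>\<^sup>2"
        using \<open>1 \<le> (r n)\<^sup>2\<close> by simp
      then have "pi * (R\<^sup>2 - (r n)\<^sup>2 + (u - l\<^sup>2 / 4) + (\<mu>\<^sup>2 / 4 - v)) \<le> pi * (R\<^sup>2 - 1 + 3 / 4 * l\<^sup>2 + 1 / 4 * \<mu>\<^sup>2)"
        by (rule mult_left_mono) simp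
      then show ?thesis by (simp add: u_def v_def algebra_simps)
    qed
    finally show ?thesis
      using lm[OF r(1)] by (simp add: M_def emeasure_eq_measure2 ennreal_leI)
  qed
  then have "(SUP n. emeasure lebesgue (M n)) \<le> ennreal ?B" by (rule SUP_least)
  then show "emeasure lebesgue A \<le> ennreal ?B"
    unfolding A using SUP_emeasure_incseq[OF image_subsetI[OF M_sets] inc] by (simp only:)
qed

lemma half_le_reduced_radius:
  fixes K R :: real
  assumes "2 * K \<le> R" "1 \<le> R"
  shows "R / 2 \<le> R - K / R\<^sup>2"
proof -
  have "2 * K \<le> R * 1" using assms by simp
  also have "\<dots> \<le> R * R\<^sup>2" using assms by (intro mult_left_mono one_le_power) auto
  finally have "K / R\<^sup>2 \<le> R / 2" using assms by (simp add: field_simps)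
  then show ?thesis by simp
qed

text \<open>
  The right-hand side, times \<open>\<pi>\<close>, is the area of the Joukowski image of \<open>a \<le> |z| \<le> s\<close> with \<open>B = |\<beta>|\<close>.
  For \<open>a\<^sup>2 = B > 0\<close> the image would be the full solid ellipse, with \<open>B\<^sup>2 / a\<^sup>2 - a\<^sup>2 = 0\<close>; the
  summand \<open>1 / R\<close> makes the map injective also on the inner circle, and keeps \<open>a > 0\<close> when \<open>B = 0\<close>,
  at the cost of \<open>O (1 / R)\<close>.
\<close>

lemma joukowski_area_lower_bound:
  fixes B K R :: real
  assumes B: "0 \<le> B" "B \<le> 1" and K: "0 \<le> K" "2 * K \<le> R" and R: "4 \<le> R"
    and a: "a\<^sup>2 = B + 1 / R" and s: "s = R - K / R\<^sup>2"
  shows "R\<^sup>2 - (2 * K + 6) / R \<le> (s\<^sup>2 - a\<^sup>2) + B\<^sup>2 * (1 / a\<^sup>2 - 1 / s\<^sup>2)"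
proof -
  have Rpos: "0 < R" "0 < 1 / R" using R by auto
  have s2: "R\<^sup>2 - 2 * K / R \<le> s\<^sup>2"
  proof -
    have "s\<^sup>2 = R\<^sup>2 - 2 * K / R + (K / R\<^sup>2)\<^sup>2"
      unfolding s using Rpos by (simp add: power2_diff) (simp add: power2_eq_square)
    then show ?thesis by simp
  qed
  have "R / 2 \<le> s" unfolding s using K R by (intro half_le_reduced_radius) auto
  then have "(R / 2)\<^sup>2 \<le> s\<^sup>2" using R by (intro power_mono) auto
  moreover have "R * 4 \<le> R * R" using R by (intro mult_left_mono) auto
  ultimately have "R \<le> s\<^sup>2" by (simp add: power2_eq_square)
  then have "1 / s\<^sup>2 \<le> 1 / R" using Rpos by (intro frac_le) auto
  moreover have "B\<^sup>2 * (1 / s\<^sup>2) \<le> 1 * (1 / s\<^sup>2)"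
    using B by (intro mult_right_mono power_le_one) auto
  ultimately have t1: "B\<^sup>2 * (1 / s\<^sup>2) \<le> 1 / R" by simp
  have "B - 1 / R \<le> B\<^sup>2 / a\<^sup>2"
  proof -
    have "(B - 1 / R) * (B + 1 / R) \<le> B\<^sup>2" by (simp add: algebra_simps power2_eq_square)
    moreover have "0 < B + 1 / R" using B Rpos by linarith
    ultimately show ?thesis unfolding a by (simp add: pos_le_divide_eq)
  qed
  then have "R\<^sup>2 - 2 * K / R - (B + 1 / R) + (B - 1 / R) - 1 / R \<le> (s\<^sup>2 - a\<^sup>2) + B\<^sup>2 * (1 / a\<^sup>2 - 1 / s\<^sup>2)"
    using s2 t1 a by (simp add: algebra_simps)
  moreover have "R\<^sup>2 - (2 * K + 6) / R \<le> R\<^sup>2 - 2 * K / R - (B + 1 / R) + (B - 1 / R) - 1 / R"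
    using Rpos divide_right_mono[of 3 6 R] by (simp add: add_divide_distrib)
  ultimately show ?thesis by linarith
qed

text \<open>
  The omitted set and the image of \<open>1 < |\<zeta>| \<le> R\<close> together cover the Joukowski image of
  \<open>a \<le> |z| \<le> s\<close>. If the omitted set had area \<open>\<pi> (1 - l\<^sup>2)\<close>, comparing areas would give
  \<open>R\<^sup>2 - O (1 / R) \<le> R\<^sup>2 - \<delta>\<close> with \<open>\<delta> = (l\<^sup>2 - \<mu>\<^sup>2) / 4\<close>.
\<close>

lemma omitted_area_strict:
  assumes hol: "G holomorphic_on ball 0 1" and G0: "G 0 = 0"
    and inj: "inj_on (\<lambda>z. z + G (inverse z)) ext_disc"
    and l: "\<And>w. norm w < 1 \<Longrightarrow> norm (deriv G w) \<le> l" "0 < l" "l \<le> 1"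
    and \<mu>: "\<And>w. norm w \<le> 1 / 2 \<Longrightarrow> norm (deriv G w) \<le> \<mu>" "0 \<le> \<mu>" "\<mu> < l"
  shows "emeasure lebesgue (omitted_set (\<lambda>z. z + G (inverse z))) \<noteq> ennreal (pi * (1 - l\<^sup>2))"
proof
  let ?f = "\<lambda>z. z + G (inverse z)"
  assume area: "emeasure lebesgue (omitted_set ?f) = ennreal (pi * (1 - l\<^sup>2))"
  define \<beta> where "\<beta> = deriv G 0"
  obtain C where C: "0 \<le> C" "\<And>w. norm w \<le> 1 / 2 \<Longrightarrow> norm (G w - \<beta> * w) \<le> C * (norm w)\<^sup>2"
    using second_order_bound[OF hol G0] unfolding \<beta>_def by blast
  have \<beta>1: "norm \<beta> \<le> 1" using l(1)[of 0] l(3) by (simp add: \<beta>_def)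
  define K where "K = 2 * C + 1"
  define \<delta> where "\<delta> = 1 / 4 * l\<^sup>2 - 1 / 4 * \<mu>\<^sup>2"
  have \<delta>: "0 < \<delta>" using \<mu> by (simp add: \<delta>_def power_strict_mono)
  \<comment> \<open>so large that the error \<open>(2 K + 6) / R\<close> in the area of the ellipse is below \<open>\<delta>\<close>\<close>
  define R where "R = max (max 4 (2 * K)) ((2 * K + 7) / \<delta>)"
  have K: "0 \<le> K" "2 * K \<le> R" and R: "4 \<le> R" and R\<delta>: "(2 * K + 7) / \<delta> \<le> R"
    using C by (auto simp: R_def K_def)
  define a where "a = sqrt (norm \<beta> + 1 / R)"
  define s where "s = R - K / R\<^sup>2"
  have a_pos: "0 < a" using R by (simp add: a_def add_nonneg_pos)
  have a2: "a\<^sup>2 = norm \<beta> + 1 / R" using R by (simp add: a_def)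
  have as: "a \<le> s"
  proof -
    have "a\<^sup>2 \<le> 2\<^sup>2" 
    proof -
      have "1 / R \<le> 1" using R by simp
      then show ?thesis using a2 \<beta>1 by simp
    qed
    then have "a \<le> 2" using power2_le_imp_le[of a 2] by simp
    moreover have "R / 2 \<le> s" unfolding s_def using K R by (intro half_le_reduced_radius) auto
    ultimately show ?thesis using R by simp
  qed
  let ?J = "\<lambda>z. z + \<beta> * inverse z"
  define A where "A = (\<Union>n. ?f ` closed_annulus (1 + 1 / real (Suc (Suc n))) R)"
  define B where "B = pi * (R\<^sup>2 - 1 + 3 / 4 * l\<^sup>2 + 1 / 4 * \<mu>\<^sup>2)"
  have A_sets: "A \<in> sets lebesgue" and A_le: "emeasure lebesgue A \<le> ennreal B"
    unfolding A_def B_def using emeasure_image_exterior_annulus_le[OF hol inj l(1) \<mu>(1), of R] R by auto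
  have "open (?f ` ext_disc)"
  proof (rule open_mapping_thm3[OF _ open_ext_disc inj])
    show "?f holomorphic_on ext_disc"
      by (rule holomorphic_on_open[OF open_ext_disc, THEN iffD2])
         (use deriv_plus_reciprocal[OF hol] inverse_ext_disc in blast)
  qed
  then have E_sets: "omitted_set ?f \<in> sets lebesgue"
    by (simp add: omitted_set_def borel_open sets.Diff)
  have J_sub: "?J ` closed_annulus a s \<subseteq> omitted_set ?f \<union> A"
  proof
    fix w assume "w \<in> ?J ` closed_annulus a s"
    then obtain z where z: "a \<le> norm z" "norm z \<le> s" "w = ?J z" by (auto simp: closed_annulus_def)
    show "w \<in> omitted_set ?f \<union> A"
    proof (rule ccontr)
      assume w: "w \<notin> omitted_set ?f \<union> A"
      then obtain \<zeta> where \<zeta>: "\<zeta> \<in> ext_disc" "w = ?f \<zeta>" by (auto simp: omitted_set_def)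
      have "R \<le> norm \<zeta>"
      proof (rule ccontr)
        assume "\<not> R \<le> norm \<zeta>"
        have "0 < norm \<zeta> - 1" using \<zeta>(1) by (simp add: ext_disc_def)
        then obtain n where "1 / real (Suc n) < norm \<zeta> - 1"
          using nat_approx_posE by blast
        moreover have "1 / real (Suc (Suc n)) \<le> 1 / real (Suc n)" by (intro frac_le) auto
        ultimately have "\<zeta> \<in> closed_annulus (1 + 1 / real (Suc (Suc n))) R"
          using \<open>\<not> R \<le> norm \<zeta>\<close> by (simp add: closed_annulus_def)
        then have "w \<in> A" using \<zeta>(2) by (auto simp: A_def)
        then show False using w by simp
      qed
      moreover have "norm \<beta> \<le> (norm z)\<^sup>2"
      proof -
        have "norm \<beta> \<le> a\<^sup>2" using a2 R by simp
        also have "\<dots> \<le> (norm z)\<^sup>2" using z a_pos by (intro power_mono) auto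
        finally show ?thesis .
      qed
      moreover have "0 < norm z" using z a_pos by linarith
      ultimately have "?J z \<noteq> ?f \<zeta>"
        using joukowski_image_disjoint[OF C(2,1) \<beta>1, of R z \<zeta>] R z by (simp add: s_def K_def)
      then show False using z \<zeta> by simp
    qed
  qed
  have J_lm: "?J ` closed_annulus a s \<in> lmeasurable"
  proof (intro lmeasurable_compact compact_continuous_image compact_closed_annulus)
    show "continuous_on (closed_annulus a s) ?J"
      using a_pos by (auto intro!: continuous_intros simp: closed_annulus_def)
  qed
  have J_inj: "inj_on ?J (closed_annulus a s)"
    using a_pos a2 R by (intro inj_on_joukowski) auto
  have "l\<^sup>2 \<le> 1" using l by (simp add: power_le_one)
  have B_eq: "B = pi * (R\<^sup>2 - 1 + l\<^sup>2 - \<delta>)" by (simp add: B_def \<delta>_def algebra_simps)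
  have B0: "0 \<le> B"
  proof -
    have "1 \<le> R\<^sup>2" using R by (intro one_le_power) auto
    moreover have "\<delta> \<le> l\<^sup>2" unfolding \<delta>_def using zero_le_power2[of \<mu>] zero_le_power2[of l] by linarith
    ultimately show ?thesis unfolding B_eq by (intro mult_nonneg_nonneg) auto
  qed
  have "ennreal (measure lebesgue (?J ` closed_annulus a s)) = emeasure lebesgue (?J ` closed_annulus a s)"
    using J_lm by (simp add: emeasure_eq_measure2)
  also have "\<dots> \<le> emeasure lebesgue (omitted_set ?f \<union> A)"
    using J_sub E_sets A_sets by (intro emeasure_mono) auto
  also have "\<dots> \<le> emeasure lebesgue (omitted_set ?f) + emeasure lebesgue A"
    using E_sets A_sets by (rule emeasure_subadditive)
  also have "\<dots> \<le> ennreal (pi * (1 - l\<^sup>2)) + ennreal B"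
    using A_le area by (simp add: add_left_mono)
  also have "\<dots> = ennreal (pi * (1 - l\<^sup>2) + B)"
    using B0 \<open>l\<^sup>2 \<le> 1\<close> by (intro ennreal_plus[symmetric]) auto
  finally have "measure lebesgue (?J ` closed_annulus a s) \<le> pi * (1 - l\<^sup>2) + B"
    using B0 \<open>l\<^sup>2 \<le> 1\<close> by (subst (asm) ennreal_le_iff) auto
  also have "\<dots> = pi * (R\<^sup>2 - \<delta>)" unfolding B_eq by (simp add: algebra_simps)
  finally have "pi * ((s\<^sup>2 - a\<^sup>2) + (norm \<beta>)\<^sup>2 * (1 / a\<^sup>2 - 1 / s\<^sup>2)) \<le> pi * (R\<^sup>2 - \<delta>)"
    unfolding measure_joukowski_image_annulus[OF a_pos as J_inj] by (simp add: algebra_simps)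
  then have "(s\<^sup>2 - a\<^sup>2) + (norm \<beta>)\<^sup>2 * (1 / a\<^sup>2 - 1 / s\<^sup>2) \<le> R\<^sup>2 - \<delta>"
    by (rule mult_left_le_imp_le) simp
  with joukowski_area_lower_bound[OF norm_ge_zero \<beta>1 K R a2 s_def]
  have "\<delta> \<le> (2 * K + 6) / R" by linarith
  then have "\<delta> * R \<le> 2 * K + 6" using R by (simp add: field_simps)
  moreover have "2 * K + 7 \<le> \<delta> * R" using R\<delta> \<delta> by (simp add: field_simps)
  ultimately show False by simp
qed

text \<open>
  The maximum of \<open>|G'|\<close> over \<open>|w| \<le> 1/2\<close> is attained and, by the strict inequality for the area, equals
  \<open>l\<close>. It is thus an interior maximum over the unit disc, so \<open>G'\<close> is constant.
\<close>

lemma norm_deriv_eq_of_omitted_area: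
  assumes hol: "G holomorphic_on ball 0 1" and G0: "G 0 = 0"
    and inj: "inj_on (\<lambda>z. z + G (inverse z)) ext_disc"
    and l: "\<And>w. norm w < 1 \<Longrightarrow> norm (deriv G w) \<le> l" "0 < l" "l \<le> 1"
    and area: "emeasure lebesgue (omitted_set (\<lambda>z. z + G (inverse z))) = ennreal (pi * (1 - l\<^sup>2))"
    and w: "norm w < 1"
  shows "norm (deriv G w) = l"
proof -
  have holG': "deriv G holomorphic_on ball 0 1" using hol by (rule holomorphic_deriv) simp
  have "continuous_on (cball 0 (1/2)) (\<lambda>w. norm (deriv G w))"
    by (intro continuous_intros holomorphic_on_imp_continuous_on holomorphic_on_subset[OF holG']) auto
  then obtain w0 where w0: "w0 \<in> cball 0 (1/2)"
      "\<And>w. w \<in> cball 0 (1/2) \<Longrightarrow> norm (deriv G w) \<le> norm (deriv G w0)"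
    using continuous_attains_sup[of "cball 0 (1/2)" "\<lambda>w. norm (deriv G w)"] by auto
  have w01: "norm w0 < 1" using w0(1) by simp
  have "\<not> norm (deriv G w0) < l"
    using omitted_area_strict[OF hol G0 inj l, of "norm (deriv G w0)"] w0 area by auto
  then have max: "norm (deriv G w0) = l" using l(1)[OF w01] by simp
  have "deriv G constant_on ball 0 1"
    by (rule maximum_modulus_principle[OF holG' _ _ _ subset_refl, of w0]) (use l(1) w01 max in auto)
  then show ?thesis using max w01 w by (auto simp: constant_on_def)
qed

section \<open>Extremality\<close>

text \<open>
  Strict convexity of balls, from the identity
  \<open>|t x + (1 - t) y|\<^sup>2 = t |x|\<^sup>2 + (1 - t) |y|\<^sup>2 - t (1 - t) |x - y|\<^sup>2\<close>.
\<close>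

lemma norm_convex_combination_eq_imp_eq:
  fixes x y :: "'a::real_inner"
  assumes "norm x \<le> l" "norm y \<le> l" "norm (t *\<^sub>R x + (1 - t) *\<^sub>R y) = l" "0 < t" "t < 1"
  shows "x = y"
proof -
  have "(norm (t *\<^sub>R x + (1 - t) *\<^sub>R y))\<^sup>2 =
      t * (norm x)\<^sup>2 + (1 - t) * (norm y)\<^sup>2 - t * (1 - t) * (norm (x - y))\<^sup>2"
    by (simp add: power2_norm_eq_inner inner_simps inner_commute[of y x] algebra_simps)
  moreover have "t * (norm x)\<^sup>2 \<le> t * l\<^sup>2" "(1 - t) * (norm y)\<^sup>2 \<le> (1 - t) * l\<^sup>2"
    using assms by (auto intro!: mult_left_mono power_mono)
  ultimately have "t * (1 - t) * (norm (x - y))\<^sup>2 \<le> 0"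
    using assms(3) by (simp add: algebra_simps)
  moreover have "0 < t * (1 - t)" using assms by simp
  ultimately have "(norm (x - y))\<^sup>2 \<le> 0" by (metis mult_le_cancel_left_pos mult_zero_right)
  then show ?thesis by simp
qed

theorem theorem3p1:
  fixes l :: real and g :: "complex \<Rightarrow> complex"
  assumes "0 < l" and "l \<le> 1"
    and "g \<in> class_M0 l"
    and "emeasure lebesgue (omitted_set g) = ennreal (pi * (1 - l\<^sup>2))"
  shows "is_extreme_point g (class_M0 l)"
proof -
  obtain G where G: "G holomorphic_on ball 0 1" "G 0 = 0"
      "\<And>z. z \<in> ext_disc \<Longrightarrow> g z = z + G (inverse z)" "\<And>w. norm w < 1 \<Longrightarrow> norm (deriv G w) \<le> l"
    using class_M0_obtain_reciprocal[OF assms(3)] by metis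
  have "inj_on g ext_disc"
    using assms(3) by (simp add: class_M0_def class_M_def class_Sigma_def)
  then have inj: "inj_on (\<lambda>z. z + G (inverse z)) ext_disc"
    using G(3) by (simp cong: inj_on_cong)
  have "omitted_set (\<lambda>z. z + G (inverse z)) = omitted_set g"
    unfolding omitted_set_def using G(3) by (simp cong: image_cong)
  then have G': "norm (deriv G w) = l" if "norm w < 1" for w
    using norm_deriv_eq_of_omitted_area[OF G(1,2) inj G(4) assms(1,2) _ that] assms(4) by simp
  have "g1 \<zeta> = g \<zeta> \<and> g2 \<zeta> = g \<zeta>"
    if g12: "g1 \<in> class_M0 l" "g2 \<in> class_M0 l" and t: "0 < t" "t < 1"
      and comb: "\<forall>\<zeta>\<in>ext_disc. g \<zeta> = of_real t * g1 \<zeta> + of_real (1 - t) * g2 \<zeta>"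
      and \<zeta>: "\<zeta> \<in> ext_disc" for g1 g2 and t :: real and \<zeta>
  proof -
    obtain G1 where G1: "G1 holomorphic_on ball 0 1" "G1 0 = 0"
        "\<And>z. z \<in> ext_disc \<Longrightarrow> g1 z = z + G1 (inverse z)" "\<And>w. norm w < 1 \<Longrightarrow> norm (deriv G1 w) \<le> l"
      using class_M0_obtain_reciprocal[OF g12(1)] by metis
    obtain G2 where G2: "G2 holomorphic_on ball 0 1" "G2 0 = 0"
        "\<And>z. z \<in> ext_disc \<Longrightarrow> g2 z = z + G2 (inverse z)" "\<And>w. norm w < 1 \<Longrightarrow> norm (deriv G2 w) \<le> l"
      using class_M0_obtain_reciprocal[OF g12(2)] by metis
    have G_comb: "G w = of_real t * G1 w + of_real (1 - t) * G2 w" if w: "w \<in> ball 0 1" for w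
    proof (cases "w = 0")
      case False
      then have "inverse w \<in> ext_disc" using w by (intro inverse_mem_ext_disc) auto
      then show ?thesis using comb G(3) G1(3) G2(3) by (auto simp: algebra_simps)
    qed (simp add: G(2) G1(2) G2(2))
    have der: "(F has_field_derivative deriv F w) (at w)" if "F holomorphic_on ball 0 1" "w \<in> ball 0 1" for F w
      using that by (intro holomorphic_derivI) auto
    have deriv_eq: "deriv G1 w = deriv G2 w" if w: "w \<in> ball 0 1" for w
    proof -
      have "((\<lambda>w. of_real t * G1 w + of_real (1 - t) * G2 w) has_field_derivative
          of_real t * deriv G1 w + of_real (1 - t) * deriv G2 w) (at w)"
        by (intro DERIV_add DERIV_cmult der G1(1) G2(1) w)
      then have "(G has_field_derivative of_real t * deriv G1 w + of_real (1 - t) * deriv G2 w) (at w)"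
        by (rule has_field_derivative_transform_within_open[OF _ open_ball w]) (simp add: G_comb)
      then have "deriv G w = t *\<^sub>R deriv G1 w + (1 - t) *\<^sub>R deriv G2 w"
        using DERIV_imp_deriv by (metis scaleR_conv_of_real)
      then show ?thesis
        using G'[of w] G1(4)[of w] G2(4)[of w] w t norm_convex_combination_eq_imp_eq[of "deriv G1 w" l "deriv G2 w" t]
        by simp
    qed
    obtain c where c: "\<And>w. w \<in> ball 0 1 \<Longrightarrow> G1 w - G2 w = c"
    proof (rule exE[OF has_field_derivative_zero_constant[of "ball 0 1" "\<lambda>w. G1 w - G2 w"]])
      show "((\<lambda>w. G1 w - G2 w) has_field_derivative 0) (at w within ball 0 1)" if "w \<in> ball 0 1" for w
        using DERIV_diff[OF der[OF G1(1) that] der[OF G2(1) that]] deriv_eq[OF that]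
        by (auto intro: has_field_derivative_at_within)
    qed auto
    have G12: "G1 w = G2 w" if "w \<in> ball 0 1" for w
      using c[OF that] c[of 0] G1(2) G2(2) by simp
    have \<zeta>': "inverse \<zeta> \<in> ball 0 1" using inverse_ext_disc[OF \<zeta>] by simp
    have "G (inverse \<zeta>) = G2 (inverse \<zeta>)"
      using G_comb[OF \<zeta>'] G12[OF \<zeta>'] by (simp add: algebra_simps)
    then show ?thesis using G12[OF \<zeta>'] G(3) G1(3) G2(3) \<zeta> by simp
  qed
  then show ?thesis
    unfolding is_extreme_point_def using assms(3) by blast
qed

end
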